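(* Let $X$ and $Y$ be two linear 2-normed spaces over the field $\mathbb{K}$ ($\mathbb{K}=\mathbb{R}$ or $\mathbb{C}$), with 2-norms $\|\cdot,\cdot\|_X$ and $\|\cdot,\cdot\|_Y$, and let $D$ be a subspace of $X$. Then a linear operator $T:D\to Y$ is closed if and only if its graph $G_T=\{(x,Tx): x\in D\}$ is a closed subspace of $X\times Y$.
   Context: Let $X$ be a linear space of dimension greater than $1$ over $\mathbb{K}$. A 2-norm on $X$ is a function $\|\cdot,\cdot\|:X\times X\to\mathbb{R}$ such that: (N1) $\|x,y\|=0$ if and only if $x,y$ are linearly dependent; (N2) $\|x,y\|=\|y,x\|$; (N3) $\|\alpha x,y\|=|\alpha|\,\|x,y\|$ for all $\alpha\in\mathbb{K}$; (N4) $\|x,y+z\|\le\|x,y\|+\|x,z\|$. The pair $(X,\|\cdot,\cdot\|)$ is then called a linear 2-normed space. A sequence $\{x_n\}$ in $X$ converges to $x\in X$ if $\lim_{n\to\infty}\|x_n-x,y\|=0$ for every $y\in X$. The product $X\times Y$ is equipped with the function $\|(x_1,y_1),(x_2,y_2)\|=\|x_1,x_2\|_X+\|y_1,y_2\|_Y$; thus a sequence $\{p_n\}$ in $X\times Y$ converges to $p\in X\times Y$ if $\lim_{n\to\infty}\|p_n-p,q\|=0$ for every $q\in X\times Y$. The closure $\overline{A}$ of a subset $A$ is the set of all limits of convergent sequences of elements of $A$; $A$ is closed if $A=\overline{A}$. A linear operator $T:D\to Y$ is closed if whenever $x_n\in D$, $x_n\to x$ in $X$ and $Tx_n\to y$ in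 $Y$, one has $x\in D$ and $Tx=y$. *)

theory Defs
  imports "HOL-Analysis.Product_Vector"
begin

text \<open>
  The scalar field is a type \<open>'k :: real_normed_field\<close>, whose norm is multiplicative. By the
  Gelfand--Mazur theorem such a field is isometrically isomorphic to \<open>\<real>\<close> or \<open>\<complex>\<close>, and both
  \<open>real\<close> and \<open>complex\<close> are instances; the norm on scalars is the absolute value.
\<close>

text \<open>
  The set-based \<^term>\<open>module.dependent\<close> cannot see the repetition in a pair \<open>(x, x)\<close>, hence the
  disjunct \<open>x = y\<close> below.
  A Hamel basis with more than one element expresses ``dimension greater than 1'' also for
  infinite-dimensional spaces, where the library's natural-number-valued \<open>dim\<close> is \<open>0\<close>.
\<close>

locale linear_two_normed_space = vector_space scale
  for scale :: "'k::real_normed_field \<Rightarrow> 'a::ab_group_add \<Rightarrow> 'a" +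
  fixes tnorm :: "'a \<Rightarrow> 'a \<Rightarrow> real"
  assumes dim_greater_one:
      "\<exists>B. independent B \<and> span B = UNIV \<and> (infinite B \<or> card B > 1)"
    and tnorm_eq_0_iff: "tnorm x y = 0 \<longleftrightarrow> x = y \<or> dependent {x, y}"
    and tnorm_commute: "tnorm x y = tnorm y x"
    and tnorm_scale: "tnorm (scale c x) y = norm c * tnorm x y"
    and tnorm_triangle: "tnorm x (y + z) \<le> tnorm x y + tnorm x z"

text \<open>
  Convergence and closure are defined for an arbitrary function \<open>N\<close> of two arguments because the
  function on the product space is in general not a 2-norm.
\<close>

definition tn_converges :: "('v::ab_group_add \<Rightarrow> 'v \<Rightarrow> real) \<Rightarrow> (nat \<Rightarrow> 'v) \<Rightarrow> 'v \<Rightarrow> bool"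
  where "tn_converges N f l \<longleftrightarrow> (\<forall>y. (\<lambda>n. N (f n - l) y) \<longlonglongrightarrow> 0)"

definition tn_closure :: "('v::ab_group_add \<Rightarrow> 'v \<Rightarrow> real) \<Rightarrow> 'v set \<Rightarrow> 'v set"
  where "tn_closure N A = {l. \<exists>f. (\<forall>n. f n \<in> A) \<and> tn_converges N f l}"

definition tn_closed :: "('v::ab_group_add \<Rightarrow> 'v \<Rightarrow> real) \<Rightarrow> 'v set \<Rightarrow> bool"
  where "tn_closed N A \<longleftrightarrow> A = tn_closure N A"

definition prod_tnorm ::
    "('a \<Rightarrow> 'a \<Rightarrow> real) \<Rightarrow> ('b \<Rightarrow> 'b \<Rightarrow> real) \<Rightarrow> 'a \<times> 'b \<Rightarrow> 'a \<times> 'b \<Rightarrow> real"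
  where "prod_tnorm NX NY p q = NX (fst p) (fst q) + NY (snd p) (snd q)"

text \<open>
  An operator with domain \<open>D\<close> is represented by a total function; the notions below depend only on
  its values on \<open>D\<close>.
\<close>

definition linear_operator_on ::
    "('k \<Rightarrow> 'a::ab_group_add \<Rightarrow> 'a) \<Rightarrow> ('k \<Rightarrow> 'b::ab_group_add \<Rightarrow> 'b) \<Rightarrow> 'a set \<Rightarrow> ('a \<Rightarrow> 'b) \<Rightarrow> bool"
  where "linear_operator_on sX sY D T \<longleftrightarrow>
    (\<forall>x\<in>D. \<forall>y\<in>D. T (x + y) = T x + T y) \<and> (\<forall>c. \<forall>x\<in>D. T (sX c x) = sY c (T x))"

definition closed_operator_on ::
    "('a::ab_group_add \<Rightarrow> 'a \<Rightarrow> real) \<Rightarrow> ('b::ab_group_add \<Rightarrow> 'b \<Rightarrow> real) \<Rightarrow> 'a set \<Rightarrow> ('a \<Rightarrow> 'b) \<Rightarrow> bool"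
  where "closed_operator_on NX NY D T \<longleftrightarrow>
    (\<forall>f x y. (\<forall>n. f n \<in> D) \<and> tn_converges NX f x \<and> tn_converges NY (\<lambda>n. T (f n)) y
      \<longrightarrow> x \<in> D \<and> T x = y)"

definition graph_on :: "'a set \<Rightarrow> ('a \<Rightarrow> 'b) \<Rightarrow> ('a \<times> 'b) set"
  where "graph_on D T = {(x, T x) | x. x \<in> D}"

end

theory Submission
  imports Defs
begin

text \<open>The function on the product is a sum of two 2-norms that vanish as soon as one argument
  is 0, so convergence for it is convergence in each component
  (\<open>tn_converges_prod_iff\<close>). Points of the graph are pairs \<open>(x, T x)\<close>;
  hence a sequence in the graph tends to \<open>(x, y)\<close> exactly when its first components
  \<open>f n\<close> tend to \<open>x\<close> and \<open>T (f n)\<close> tends to \<open>y\<close>.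
  Closedness of \<open>T\<close> therefore says that the graph contains all its sequential limits
  (\<open>closed_operator_on_iff\<close>). Linearity of \<open>T\<close> on a subspace makes the
  graph a subspace (\<open>subspace_graph_on\<close>).\<close>

context linear_two_normed_space
begin

lemma tnorm_zero_left [simp]: "tnorm 0 y = 0"
  using tnorm_scale[of 0 0 y] by simp

text \<open>A zero test vector kills one summand of \<open>prod_tnorm\<close>, so the other
  component can be examined alone.\<close>

lemma tnorm_zero_right [simp]: "tnorm x 0 = 0"
  using tnorm_commute[of x 0] by simp

end

lemma tn_converges_const:
  assumes "\<And>y. N 0 y = 0"
  shows "tn_converges N (\<lambda>_. l) l"
  using assms by (simp add: tn_converges_def)

text \<open>Testing against \<open>(y, 0)\<close> and \<open>(0, y)\<close> separates the components.\<close>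

lemma tn_converges_prod_iff:
  assumes "\<And>x. NX x 0 = 0" and "\<And>y. NY y 0 = 0"
  shows "tn_converges (prod_tnorm NX NY) p l \<longleftrightarrow>
    tn_converges NX (\<lambda>n. fst (p n)) (fst l) \<and> tn_converges NY (\<lambda>n. snd (p n)) (snd l)"
proof
  assume conv: "tn_converges (prod_tnorm NX NY) p l"
  have "(\<lambda>n. NX (fst (p n) - fst l) x) \<longlonglongrightarrow> 0" for x
    using conv[unfolded tn_converges_def, rule_format, of "(x, 0)"]
    by (simp add: prod_tnorm_def assms)
  moreover have "(\<lambda>n. NY (snd (p n) - snd l) y) \<longlonglongrightarrow> 0" for y
    using conv[unfolded tn_converges_def, rule_format, of "(0, y)"]
    by (simp add: prod_tnorm_def assms)
  ultimately show "tn_converges NX (\<lambda>n. fst (p n)) (fst l) \<and>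
      tn_converges NY (\<lambda>n. snd (p n)) (snd l)"
    by (simp add: tn_converges_def)
qed (auto simp: tn_converges_def prod_tnorm_def intro!: tendsto_add_zero)

lemma graph_on_iff: "p \<in> graph_on D T \<longleftrightarrow> fst p \<in> D \<and> snd p = T (fst p)"
  by (cases p) (auto simp: graph_on_def)

lemma subspace_graph_on:
  fixes sX :: "'k::field \<Rightarrow> 'a::ab_group_add \<Rightarrow> 'a"
    and sY :: "'k \<Rightarrow> 'b::ab_group_add \<Rightarrow> 'b"
  assumes "vector_space sX" and "vector_space sY"
    and D: "module.subspace sX D" and T: "linear_operator_on sX sY D T"
  shows "module.subspace (module_prod.scale sX sY) (graph_on D T)"
proof -
  interpret X: vector_space sX by fact
  interpret Y: vector_space sY by fact
  interpret P: vector_space_prod sX sY by unfold_locales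
  \<comment> \<open>Homogeneity with scalar 0, applied at the point 0 of \<open>D\<close>, since
    additivity and homogeneity are available only on \<open>D\<close>.\<close>
  have "T 0 = 0"
    using T X.subspace_0[OF D] by (metis linear_operator_on_def X.scale_zero_left Y.scale_zero_left)
  then show ?thesis
    using T X.subspace_0[OF D] X.subspace_add[OF D] X.subspace_scale[OF D]
    by (auto simp: P.p.subspace_def graph_on_iff P.scale_def linear_operator_on_def)
qed

text \<open>Sequences in the graph correspond to sequences \<open>f\<close> in \<open>D\<close> via
  \<open>(f n, T (f n))\<close>, and \<open>(x, y)\<close> lies in the graph iff \<open>x\<close> is
  in \<open>D\<close> and \<open>T x = y\<close>. With componentwise convergence, both sides make
  the same demand on the same sequences and limits.\<close>

lemma closed_operator_on_iff:
  assumes "\<And>x. NX x 0 = 0" and "\<And>y. NY y 0 = 0"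
  shows "closed_operator_on NX NY D T \<longleftrightarrow>
    tn_closure (prod_tnorm NX NY) (graph_on D T) \<subseteq> graph_on D T"
proof
  assume closed: "closed_operator_on NX NY D T"
  show "tn_closure (prod_tnorm NX NY) (graph_on D T) \<subseteq> graph_on D T"
  proof
    fix l
    assume "l \<in> tn_closure (prod_tnorm NX NY) (graph_on D T)"
    then obtain p where p: "\<And>n. p n \<in> graph_on D T" "tn_converges (prod_tnorm NX NY) p l"
      by (auto simp: tn_closure_def)
    then have "tn_converges NX (\<lambda>n. fst (p n)) (fst l)"
      "tn_converges NY (\<lambda>n. T (fst (p n))) (snd l)"
      by (auto simp: tn_converges_prod_iff[of NX NY, OF assms] graph_on_iff)
    then show "l \<in> graph_on D T"
      using closed p(1) unfolding closed_operator_on_def graph_on_iff by metis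
  qed
next
  assume sub: "tn_closure (prod_tnorm NX NY) (graph_on D T) \<subseteq> graph_on D T"
  show "closed_operator_on NX NY D T"
    unfolding closed_operator_on_def
  proof (intro allI impI)
    fix f x y
    assume "(\<forall>n. f n \<in> D) \<and> tn_converges NX f x \<and> tn_converges NY (\<lambda>n. T (f n)) y"
    then have "(x, y) \<in> tn_closure (prod_tnorm NX NY) (graph_on D T)"
      unfolding tn_closure_def
      by (auto simp: tn_converges_prod_iff[of NX NY, OF assms] graph_on_iff
          intro!: exI[of _ "\<lambda>n. (f n, T (f n))"])
    with sub show "x \<in> D \<and> T x = y"
      by (auto simp: graph_on_iff)
  qed
qed

theorem theorem3p2:
  fixes sX :: "'k::real_normed_field \<Rightarrow> 'a::ab_group_add \<Rightarrow> 'a"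
    and sY :: "'k \<Rightarrow> 'b::ab_group_add \<Rightarrow> 'b"
    and NX :: "'a \<Rightarrow> 'a \<Rightarrow> real"
    and NY :: "'b \<Rightarrow> 'b \<Rightarrow> real"
    and D :: "'a set"
    and T :: "'a \<Rightarrow> 'b"
  assumes "linear_two_normed_space sX NX"
    and "linear_two_normed_space sY NY"
    and "module.subspace sX D"
    and "linear_operator_on sX sY D T"
  shows "closed_operator_on NX NY D T \<longleftrightarrow>
    module.subspace (module_prod.scale sX sY) (graph_on D T) \<and>
    tn_closed (prod_tnorm NX NY) (graph_on D T)"
proof -
  interpret X: linear_two_normed_space sX NX by fact
  interpret Y: linear_two_normed_space sY NY by fact
  have "module.subspace (module_prod.scale sX sY) (graph_on D T)"
    using X.vector_space_axioms Y.vector_space_axioms assms(3,4) by (rule subspace_graph_on)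
  \<comment> \<open>Each point is the limit of its constant sequence, because both 2-norms vanish
    when the first argument is 0. This turns the inclusion of \<open>closed_operator_on_iff\<close>
    into the equality required by \<open>tn_closed\<close>.\<close>
  moreover have "graph_on D T \<subseteq> tn_closure (prod_tnorm NX NY) (graph_on D T)"
    using tn_converges_const[of "prod_tnorm NX NY"]
    by (fastforce simp: tn_closure_def prod_tnorm_def)
  ultimately show ?thesis
    using closed_operator_on_iff[of NX NY D T] by (auto simp: tn_closed_def)
qed

end
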